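(* Let $d\ge2$, $\bm{\theta}=(\theta_1,\dots,\theta_d),\bm{\xi}=(\xi_1,\dots,\xi_d)\in\mathbb{R}^d$, and let $C_{\bm\theta,\bm\xi}$ be the conjugation on $H^2(\mathbb{D}^d)$ given by \[ C_{\bm\theta,\bm\xi}\Big(\sum_{\bm{k}\in\mathbb{Z}_+^d}a_{\bm{k}}z^{\bm{k}}\Big)=\exp\Big(i\sum_{j=1}^d\xi_j\Big)\sum_{\bm{k}\in\mathbb{Z}_+^d}\overline{a_{\bm{k}}}\exp\Big(-i\sum_{j=1}^dk_j\theta_j\Big)z^{\bm{k}}. \] Let $\varphi=\sum_{\bm{k}\in\mathbb{Z}^d}\varphi(\bm{k})z^{\bm{k}}\in L^\infty(\mathbb{T}^d)$. Then $T_\varphi$ is $C_{\bm\theta,\bm\xi}$-symmetric if and only if \[ \exp\Big(i\sum_{j=1}^dk_j\theta_j\Big)\varphi(\bm{k})=\varphi(-\bm{k})\qquad(\bm{k}\in\mathbb{Z}^d). \]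
   Context: A conjugation is an anti-linear, involutive, isometric map; $T$ is $C$-symmetric if $CT^*C=T$. $H^2(\mathbb{D}^d)$ is the Hardy space over the polydisc, viewed as the closed subspace of $L^2(\mathbb{T}^d)$ with orthonormal basis $\{z^{\bm{k}}\}_{\bm{k}\in\mathbb{Z}_+^d}$, $z^{\bm{k}}=z_1^{k_1}\cdots z_d^{k_d}$. For $\varphi\in L^\infty(\mathbb{T}^d)$ with Fourier coefficients $\varphi(\bm{k})$, $T_\varphi f=P_{H^2(\mathbb{D}^d)}(\varphi f)$. *)

theory Defs
  imports "HOL-Analysis.Analysis"
begin

text \<open>The torus T^d is parametrised by angles t in the box [0,2pi]^d
  (z_j = exp(i t_j)); functions on T^d are functions of the angle vector.
  The index type 'd (finite) plays the role of {1..d}.\<close>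

definition torus_box :: "(real^'d::finite) set" where
  "torus_box = cbox 0 (\<chi> j. 2 * pi)"

definition TM :: "(real^'d::finite) measure" where
  "TM = restrict_space lborel torus_box"

definition zpow :: "int^'d::finite \<Rightarrow> real^'d \<Rightarrow> complex" where
  "zpow k t = exp (\<i> * complex_of_real (\<Sum>j\<in>UNIV. real_of_int (k$j) * t$j))"

definition L2 :: "(real^'d::finite \<Rightarrow> complex) set" where
  "L2 = {f. f \<in> borel_measurable TM \<and> integrable TM (\<lambda>t. (cmod (f t))^2)}"

definition Linf :: "(real^'d::finite \<Rightarrow> complex) set" where
  "Linf = {f. f \<in> borel_measurable TM \<and> (\<exists>B. AE t in TM. cmod (f t) \<le> B)}"

definition l2_inner :: "(real^'d::finite \<Rightarrow> complex) \<Rightarrow> (real^'d \<Rightarrow> complex) \<Rightarrow> complex" where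
  "l2_inner f g = integral\<^sup>L TM (\<lambda>t. f t * cnj (g t)) / (2 * pi) ^ CARD('d)"

definition fourier_coeff :: "(real^'d::finite \<Rightarrow> complex) \<Rightarrow> int^'d \<Rightarrow> complex" where
  "fourier_coeff f k = l2_inner f (zpow k)"

definition H2 :: "(real^'d::finite \<Rightarrow> complex) set" where
  "H2 = {f \<in> L2. \<forall>k. (\<exists>j. k$j < 0) \<longrightarrow> fourier_coeff f k = 0}"

text \<open>orthogonal projection onto H^2 (defined up to a.e. equality)\<close>
definition P_H2 :: "(real^'d::finite \<Rightarrow> complex) \<Rightarrow> (real^'d \<Rightarrow> complex)" where
  "P_H2 g = (SOME h. h \<in> H2 \<and> (\<forall>u\<in>H2. l2_inner (\<lambda>t. g t - h t) u = 0))"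

definition toeplitz :: "(real^'d::finite \<Rightarrow> complex) \<Rightarrow> (real^'d \<Rightarrow> complex) \<Rightarrow> (real^'d \<Rightarrow> complex)" where
  "toeplitz \<phi> f = P_H2 (\<lambda>t. \<phi> t * f t)"

definition h2_adjoint :: "((real^'d::finite \<Rightarrow> complex) \<Rightarrow> (real^'d \<Rightarrow> complex))
    \<Rightarrow> (real^'d \<Rightarrow> complex) \<Rightarrow> (real^'d \<Rightarrow> complex)" where
  "h2_adjoint T g = (SOME h. h \<in> H2 \<and> (\<forall>f\<in>H2. l2_inner (T f) g = l2_inner f h))"

definition C_symmetric ::
  "((real^'d::finite \<Rightarrow> complex) \<Rightarrow> (real^'d \<Rightarrow> complex))
   \<Rightarrow> ((real^'d \<Rightarrow> complex) \<Rightarrow> (real^'d \<Rightarrow> complex)) \<Rightarrow> bool" where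
  "C_symmetric C T \<longleftrightarrow> (\<forall>f\<in>H2. AE t in TM. C (h2_adjoint T (C f)) t = T f t)"

definition conjC :: "real^'d::finite \<Rightarrow> real^'d \<Rightarrow> (real^'d \<Rightarrow> complex) \<Rightarrow> (real^'d \<Rightarrow> complex)" where
  "conjC \<theta> \<xi> f = (SOME h. h \<in> H2 \<and> (\<forall>k. (\<forall>j. 0 \<le> k$j) \<longrightarrow>
      fourier_coeff h k = exp (\<i> * complex_of_real (\<Sum>j\<in>UNIV. \<xi>$j)) * cnj (fourier_coeff f k)
        * exp (- \<i> * complex_of_real (\<Sum>j\<in>UNIV. real_of_int (k$j) * \<theta>$j))))"

end

theory Submission
  imports Defs
begin

text \<open>
  Comparing Fourier coefficients, symmetry of the Toeplitz operator says that for all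
  \<open>f\<close> in \<open>H2\<close> and all \<open>k \<ge> 0\<close> one has \<open>exp (i \<Sum>\<xi>) exp (- i k\<theta>) <\<phi> z^k, C f> = <\<phi> f, z^k>\<close>.
  For \<open>f = z^m\<close> this is the claimed relation for \<open>\<phi>(m - k)\<close>, and every index is such a difference.
  Conversely, Parseval's identity expands both sides as series over \<open>m \<ge> 0\<close>, and the relation makes
  them agree term by term. The projection, the adjoint and the conjugation are Hilbert choices, so
  they are controlled only once Riesz--Fischer provides witnesses; that the coefficients determine
  a function almost everywhere comes from the Stone--Weierstrass theorem on the torus.
\<close>

subsection \<open>Orthogonality of the monomials\<close>

lemma space_TM: "space TM = torus_box"
  by (simp add: TM_def space_restrict_space)

lemma sets_torus_box [measurable, simp]: "torus_box \<in> sets borel"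
  by (simp add: torus_box_def)

interpretation TM: finite_measure "TM :: (real^'d::finite) measure"
proof
  show "emeasure (TM :: (real^'d) measure) (space TM) \<noteq> \<infinity>"
    using emeasure_lborel_cbox_finite[of "0::real^'d" "\<chi> j. 2 * pi"]
    by (simp add: space_TM) (simp add: TM_def emeasure_restrict_space torus_box_def)
qed

lemma borel_measurable_TM [measurable (raw)]:
  "f \<in> borel_measurable borel \<Longrightarrow> f \<in> borel_measurable TM"
  by (simp add: TM_def measurable_restrict_space1)

lemma zpow_measurable [measurable]: "zpow k \<in> borel_measurable borel"
  unfolding zpow_def by (intro borel_measurable_continuous_onI continuous_intros)

lemma norm_zpow [simp]: "cmod (zpow k t) = 1"
  by (simp add: zpow_def)

lemma zpow_add: "zpow (k + m) t = zpow k t * zpow m t"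
  by (simp add: zpow_def sum.distrib algebra_simps exp_add[symmetric])

lemma cnj_zpow: "cnj (zpow k t) = zpow (- k) t"
  by (simp add: zpow_def exp_cnj sum_negf)

lemma zpow_0 [simp]: "zpow 0 t = 1"
  by (simp add: zpow_def)

lemma zpow_diff: "zpow (k - m) t = zpow k t * cnj (zpow m t)"
  using zpow_add[of k "-m" t] by (simp add: cnj_zpow)

lemma integral_exp_period:
  fixes n :: int
  shows "(LBINT x. indicator {0..2*pi} x *\<^sub>R exp (\<i> * complex_of_real (of_int n * x)))
    = (if n = 0 then 2 * pi else 0)"
proof (cases "n = 0")
  case True
  then show ?thesis by (simp add: scaleR_conv_of_real)
next
  case False
  have "((\<lambda>z. exp (\<i> * (of_int n * z)) / (\<i> * of_int n)) has_field_derivative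
      exp (\<i> * (of_int n * z))) (at z)" for z
    using False by (auto intro!: derivative_eq_intros simp: field_simps)
  from has_vector_derivative_real_field[OF this]
  have "(LBINT x. indicator {0..2*pi} x *\<^sub>R exp (\<i> * complex_of_real (of_int n * x)))
     = exp (\<i> * complex_of_real (of_int n * (2*pi))) / (\<i> * of_int n)
      - exp (\<i> * complex_of_real (of_int n * 0)) / (\<i> * of_int n)"
    by (intro integral_FTC_Icc continuous_intros) auto
  also have "exp (\<i> * complex_of_real (of_int n * (2*pi))) = 1"
    by (metis exp_two_pi_i' exp_eq_1 exp_integer_2pi Ints_of_int mult.commute mult.left_commute of_real_mult of_real_of_int_eq of_real_numeral)
  finally show ?thesis using False by simp
qed

text \<open>The character is a product of one-variable exponentials, so Fubini reduces the integral
  to \<open>integral_exp_period\<close> in each coordinate; one nonzero frequency makes the whole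
  product vanish.\<close>

lemma integral_zpow:
  fixes k :: "int^'d::finite"
  shows "integral\<^sup>L TM (zpow k) = (if k = 0 then (2 * pi) ^ CARD('d) else 0)"
proof -
  define kk :: "real^'d" where "kk = (\<chi> j. of_int (k $ j))"
  \<comment> \<open>The indicator of the interval is built into each factor, so that the product
    over \<open>Basis\<close> carries the indicator of the whole box as well.\<close>
  define f where "f b x = indicator {0..2*pi} x *\<^sub>R exp (\<i> * complex_of_real ((kk \<bullet> b) * x))"
    for b :: "real^'d" and x :: real
  have kkb: "\<exists>n. kk \<bullet> b = of_int n" if "b \<in> Basis" for b
    using that by (auto simp: Basis_vec_def kk_def inner_axis)
  interpret product_sigma_finite "\<lambda>_::real^'d. lborel :: real measure" ..
  have int: "integrable lborel (f b)" for b
    unfolding f_def by (intro borel_integrable_compact continuous_intros) auto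
  have pt: "indicator torus_box t *\<^sub>R zpow k t = (\<Prod>b\<in>Basis. f b (t \<bullet> b))" for t :: "real^'d"
  proof -
    have "(\<Sum>j\<in>UNIV. real_of_int (k$j) * t$j) = kk \<bullet> t"
      by (simp add: inner_vec_def kk_def)
    also have "\<dots> = (\<Sum>b\<in>Basis. (kk \<bullet> b) * (t \<bullet> b))"
      by (rule euclidean_inner)
    finally have z: "zpow k t = (\<Prod>b\<in>Basis. exp (\<i> * complex_of_real ((kk \<bullet> b) * (t \<bullet> b))))"
      by (simp add: zpow_def exp_sum sum_distrib_left)
    have box: "(t \<in> torus_box) = (\<forall>b\<in>Basis. t \<bullet> b \<in> {0..2*pi})"
      by (auto simp: torus_box_def mem_box Basis_vec_def inner_axis)
    show ?thesis
    proof (cases "t \<in> torus_box")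
      case True
      then show ?thesis using box by (auto simp: z f_def intro!: prod.cong)
    next
      case False
      then obtain b where "b \<in> Basis" "t \<bullet> b \<notin> {0..2*pi}" using box by auto
      then show ?thesis using False by (auto simp: f_def intro!: bexI[of _ b])
    qed
  qed
  have "integral\<^sup>L TM (zpow k) = (LBINT t. indicator torus_box t *\<^sub>R zpow k t)"
    by (simp add: TM_def integral_restrict_space)
  also have "\<dots> = (LBINT t. (\<Prod>b\<in>Basis. f b (t \<bullet> b)))"
    by (simp add: pt)
  \<comment> \<open>Lebesgue measure on the Euclidean space is the image of the product of
    one-dimensional Lebesgue measures indexed by \<open>Basis\<close>; this is where the integral
    becomes one over a product measure.\<close>
  also have "\<dots> = (\<integral>x. (\<Prod>b\<in>Basis. f b ((\<Sum>c\<in>Basis. x c *\<^sub>R c) \<bullet> b)) \<partial>(\<Pi>\<^sub>M b\<in>Basis. lborel))"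
    by (subst lborel_eq, subst integral_distr) (auto simp: f_def)
  also have "\<dots> = (\<integral>x. (\<Prod>b\<in>Basis. f b (x b)) \<partial>(\<Pi>\<^sub>M b\<in>Basis. lborel))"
    by (intro Bochner_Integration.integral_cong prod.cong) (auto simp: inner_sum_left inner_Basis if_distrib sum.delta cong: if_cong)
  also have "\<dots> = (\<Prod>b\<in>Basis. integral\<^sup>L lborel (f b))"
    by (rule product_integral_prod) (auto simp: int)
  also have "\<dots> = (\<Prod>b\<in>(Basis::(real^'d) set). if kk \<bullet> b = 0 then 2 * complex_of_real pi else 0)"
  proof (rule prod.cong)
    fix b :: "real^'d" assume "b \<in> Basis"
    then obtain n where "kk \<bullet> b = of_int n" using kkb by blast
    then show "integral\<^sup>L lborel (f b) = (if kk \<bullet> b = 0 then 2 * complex_of_real pi else 0)"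
      using integral_exp_period[of n] by (simp add: f_def[abs_def])
  qed simp
  also have "\<dots> = (if k = 0 then (2 * pi) ^ CARD('d) else 0)"
  proof (cases "k = 0")
    case True
    then have "kk = 0" by (simp add: kk_def vec_eq_iff)
    then show ?thesis using True by simp
  next
    case False
    then obtain j where "k $ j \<noteq> 0" by (auto simp: vec_eq_iff)
    then have "kk \<bullet> axis j 1 \<noteq> 0" by (simp add: kk_def inner_axis)
    then show ?thesis using False by (auto intro!: bexI[of _ "axis j 1"] simp: axis_in_Basis_iff)
  qed
  finally show ?thesis .
qed

subsection \<open>The inner product on L2\<close>

text \<open>A real-valued squared norm with the normalisation of \<open>l2_inner\<close>, so that it
  can be used directly in inequalities.\<close>

definition l2sq :: "(real^'d::finite \<Rightarrow> complex) \<Rightarrow> real" where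
  "l2sq f = integral\<^sup>L TM (\<lambda>t. (cmod (f t))\<^sup>2) / (2 * pi) ^ CARD('d)"

lemma borel_measurable_cnj [measurable (raw)]:
  "f \<in> borel_measurable M \<Longrightarrow> (\<lambda>x. cnj (f x)) \<in> borel_measurable M"
  by (rule borel_measurable_continuous_on[OF continuous_on_cnj[OF continuous_on_id]])

lemma L2_measurable: "f \<in> L2 \<Longrightarrow> f \<in> borel_measurable TM"
  by (simp add: L2_def)

lemma L2_integrable_sq: "f \<in> L2 \<Longrightarrow> integrable TM (\<lambda>t. (cmod (f t))\<^sup>2)"
  by (simp add: L2_def)

text \<open>Dominated pointwise by the sum of the two squares, since ab \<le> a^2 + b^2 for
  nonnegative a and b.\<close>

lemma L2_integrable_mult:
  assumes "f \<in> L2" "g \<in> L2"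
  shows "integrable TM (\<lambda>t. f t * g t)"
proof (rule Bochner_Integration.integrable_bound)
  show "integrable TM (\<lambda>t. (cmod (f t))\<^sup>2 + (cmod (g t))\<^sup>2)"
    using assms by (auto intro: L2_integrable_sq)
  show "(\<lambda>t. f t * g t) \<in> borel_measurable TM"
    using assms by (auto intro!: borel_measurable_times dest: L2_measurable)
  have "a * b \<le> a\<^sup>2 + b\<^sup>2" if "a \<ge> 0" "b \<ge> 0" for a b :: real
    using sum_squares_bound[of a b] mult_nonneg_nonneg[OF that] by linarith
  then show "AE t in TM. norm (f t * g t) \<le> norm ((cmod (f t))\<^sup>2 + (cmod (g t))\<^sup>2)"
    by (auto simp: norm_mult)
qed

lemma L2_cnj: "f \<in> L2 \<Longrightarrow> (\<lambda>t. cnj (f t)) \<in> L2"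
  by (auto simp: L2_def)

lemma L2_add:
  assumes "f \<in> L2" "g \<in> L2"
  shows "(\<lambda>t. f t + g t) \<in> L2"
proof -
  have "integrable TM (\<lambda>t. (cmod (f t + g t))\<^sup>2)"
  proof (rule Bochner_Integration.integrable_bound)
    show "integrable TM (\<lambda>t. 2 * (cmod (f t))\<^sup>2 + 2 * (cmod (g t))\<^sup>2)"
      using assms[THEN L2_integrable_sq] by simp
    show "(\<lambda>t. (cmod (f t + g t))\<^sup>2) \<in> borel_measurable TM"
      using assms[THEN L2_measurable] by measurable
    have "(cmod (a + b))\<^sup>2 \<le> 2 * (cmod a)\<^sup>2 + 2 * (cmod b)\<^sup>2" for a b
    proof -
      have "(cmod (a + b))\<^sup>2 \<le> (cmod a + cmod b)\<^sup>2"
        by (intro power_mono norm_triangle_ineq) auto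
      also have "\<dots> \<le> 2 * (cmod a)\<^sup>2 + 2 * (cmod b)\<^sup>2"
        using sum_squares_bound[of "cmod a" "cmod b"] by (simp add: power2_sum)
      finally show ?thesis .
    qed
    then show "AE t in TM. norm ((cmod (f t + g t))\<^sup>2) \<le> norm (2 * (cmod (f t))\<^sup>2 + 2 * (cmod (g t))\<^sup>2)"
      by auto
  qed
  then show ?thesis using assms by (auto simp: L2_def)
qed

lemma Linf_mult_L2:
  assumes "\<phi> \<in> Linf" "f \<in> L2"
  shows "(\<lambda>t. \<phi> t * f t) \<in> L2"
proof -
  from assms(1) obtain B where B: "AE t in TM. cmod (\<phi> t) \<le> B" and [measurable]: "\<phi> \<in> borel_measurable TM"
    by (auto simp: Linf_def)
  have [measurable]: "f \<in> borel_measurable TM" using assms(2) by (rule L2_measurable)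
  have "integrable TM (\<lambda>t. (cmod (\<phi> t * f t))\<^sup>2)"
  proof (rule Bochner_Integration.integrable_bound)
    show "integrable TM (\<lambda>t. B\<^sup>2 * (cmod (f t))\<^sup>2)"
      using assms by (auto intro: L2_integrable_sq)
    show "AE t in TM. norm ((cmod (\<phi> t * f t))\<^sup>2) \<le> norm (B\<^sup>2 * (cmod (f t))\<^sup>2)"
      using B by eventually_elim (auto simp: norm_mult power_mult_distrib intro!: mult_right_mono power_mono)
  qed measurable
  then show ?thesis by (auto simp: L2_def)
qed

lemma const_Linf: "(\<lambda>_. c) \<in> Linf"
  by (auto simp: Linf_def)

lemma Linf_cnj: "\<phi> \<in> Linf \<Longrightarrow> (\<lambda>t. cnj (\<phi> t)) \<in> Linf"
  by (auto simp: Linf_def)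

lemma L2_cmult: "f \<in> L2 \<Longrightarrow> (\<lambda>t. c * f t) \<in> L2"
  by (rule Linf_mult_L2[OF const_Linf])

lemma L2_diff:
  assumes "f \<in> L2" "g \<in> L2"
  shows "(\<lambda>t. f t - g t) \<in> L2"
  using L2_add[OF assms(1) L2_cmult[OF assms(2), of "-1"]] by simp

lemma zpow_L2: "zpow k \<in> L2"
  by (auto simp: L2_def)

lemma const_L2: "(\<lambda>_. c) \<in> L2"
  by (auto simp: L2_def)

lemma L2_sum: "(\<And>i. i \<in> I \<Longrightarrow> f i \<in> L2) \<Longrightarrow> (\<lambda>t. \<Sum>i\<in>I. f i t) \<in> L2"
  by (induction I rule: infinite_finite_induct) (auto intro: const_L2 L2_add)

lemma L2_integrable: "f \<in> L2 \<Longrightarrow> integrable TM f"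
  using L2_integrable_mult[OF _ const_L2[of 1]] by simp

lemma L2_integrable_inner: "f \<in> L2 \<Longrightarrow> g \<in> L2 \<Longrightarrow> integrable TM (\<lambda>t. f t * cnj (g t))"
  by (intro L2_integrable_mult L2_cnj)

lemma l2_inner_diff_left:
  "f \<in> L2 \<Longrightarrow> g \<in> L2 \<Longrightarrow> h \<in> L2 \<Longrightarrow> l2_inner (\<lambda>t. f t - g t) h = l2_inner f h - l2_inner g h"
  using L2_integrable_inner[of f h] L2_integrable_inner[of g h]
  by (simp add: l2_inner_def left_diff_distrib diff_divide_distrib)

lemma l2_inner_cmult_left: "l2_inner (\<lambda>t. c * f t) h = c * l2_inner f h"
  by (simp add: l2_inner_def mult.assoc)

lemma l2_inner_sum_left:
  assumes "\<And>i. i \<in> I \<Longrightarrow> f i \<in> L2" "h \<in> L2"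
  shows "l2_inner (\<lambda>t. \<Sum>i\<in>I. f i t) h = (\<Sum>i\<in>I. l2_inner (f i) h)"
  using assms L2_integrable_inner[OF assms(1) assms(2)]
  by (simp add: l2_inner_def sum_distrib_right sum_divide_distrib)

lemma cnj_l2_inner: "cnj (l2_inner f g) = l2_inner g f"
  using Bochner_Integration.integral_cnj[of TM "\<lambda>t. f t * cnj (g t)"]
  by (simp add: l2_inner_def mult.commute)

lemma l2_inner_mult_left: "l2_inner (\<lambda>t. \<phi> t * f t) g = l2_inner f (\<lambda>t. cnj (\<phi> t) * g t)"
  by (simp add: l2_inner_def mult_ac)

lemma l2_inner_self: "l2_inner f f = complex_of_real (l2sq f)"
  by (simp add: l2_inner_def l2sq_def flip: complex_norm_square integral_complex_of_real)

lemma l2_inner_zpow: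
  fixes k m :: "int^'d::finite"
  shows "l2_inner (zpow k) (zpow m) = (if k = m then 1 else 0)"
proof -
  have "l2_inner (zpow k) (zpow m) = integral\<^sup>L TM (zpow (k - m)) / (2 * pi) ^ CARD('d)"
    by (simp add: l2_inner_def zpow_diff[abs_def])
  then show ?thesis by (simp add: integral_zpow)
qed

lemma l2sq_nonneg: "0 \<le> l2sq f"
  by (simp add: l2sq_def)

text \<open>The inequality for nonnegative integrals is applied to the moduli and carried over to
  Bochner integrals, which is possible because all three integrands are integrable.\<close>

lemma l2_Cauchy_Schwarz:
  fixes f g :: "real^'d::finite \<Rightarrow> complex"
  assumes "f \<in> L2" "g \<in> L2"
  shows "(cmod (l2_inner f g))\<^sup>2 \<le> l2sq f * l2sq g"
proof -
  note [measurable] = L2_measurable[OF assms(1)] L2_measurable[OF assms(2)]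
  have i: "integrable TM (\<lambda>t. cmod (f t) * cmod (g t))"
    using integrable_norm[OF L2_integrable_mult[OF assms]] by (simp add: norm_mult)
  have "(\<integral>\<^sup>+t. ennreal (cmod (f t)) * ennreal (cmod (g t)) \<partial>TM)\<^sup>2
    \<le> (\<integral>\<^sup>+t. (ennreal (cmod (f t)))\<^sup>2 \<partial>TM) * (\<integral>\<^sup>+t. (ennreal (cmod (g t)))\<^sup>2 \<partial>TM)"
    by (rule Cauchy_Schwarz_nn_integral) auto
  then have le: "(integral\<^sup>L TM (\<lambda>t. cmod (f t) * cmod (g t)))\<^sup>2
    \<le> integral\<^sup>L TM (\<lambda>t. (cmod (f t))\<^sup>2) * integral\<^sup>L TM (\<lambda>t. (cmod (g t))\<^sup>2)"
    using i assms[THEN L2_integrable_sq]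
    by (simp add: ennreal_mult[symmetric] nn_integral_eq_integral ennreal_power)
  have "cmod (integral\<^sup>L TM (\<lambda>t. f t * cnj (g t))) \<le> integral\<^sup>L TM (\<lambda>t. cmod (f t) * cmod (g t))"
    using integral_norm_bound[of TM "\<lambda>t. f t * cnj (g t)"] by (simp add: norm_mult)
  then have "(cmod (integral\<^sup>L TM (\<lambda>t. f t * cnj (g t))))\<^sup>2
    \<le> integral\<^sup>L TM (\<lambda>t. (cmod (f t))\<^sup>2) * integral\<^sup>L TM (\<lambda>t. (cmod (g t))\<^sup>2)"
    using le by (meson norm_ge_zero order_trans power_mono)
  \<comment> \<open>The normalising constant occurs squared on both sides: once through the square
    of the inner product, once as the product of two factors \<open>l2sq\<close>.\<close>
  then have "(cmod (integral\<^sup>L TM (\<lambda>t. f t * cnj (g t))) / (2 * pi) ^ CARD('d))\<^sup>2 \<le> l2sq f * l2sq g"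
    unfolding l2sq_def power_divide times_divide_times_eq
    by (simp only: power2_eq_square[of "(2 * pi) ^ CARD('d)"]) (intro divide_right_mono, auto)
  moreover have "cmod (l2_inner f g) = cmod (integral\<^sup>L TM (\<lambda>t. f t * cnj (g t))) / (2 * pi) ^ CARD('d)"
    by (simp add: l2_inner_def norm_divide norm_mult norm_power)
  ultimately show ?thesis by simp
qed

lemma l2_inner_AE_cong_left:
  assumes "f \<in> L2" "f' \<in> L2" "g \<in> L2" "AE t in TM. f t = f' t"
  shows "l2_inner f g = l2_inner f' g"
proof -
  note [measurable] = assms(1-3)[THEN L2_measurable]
  have "integral\<^sup>L TM (\<lambda>t. f t * cnj (g t)) = integral\<^sup>L TM (\<lambda>t. f' t * cnj (g t))"
    using assms(4) by (intro integral_cong_AE) auto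
  then show ?thesis by (simp add: l2_inner_def)
qed

section \<open>Finite Fourier sums and Bessel's inequality\<close>

definition fourier_sum :: "(int^'d::finite \<Rightarrow> complex) \<Rightarrow> (int^'d) set \<Rightarrow> real^'d \<Rightarrow> complex" where
  "fourier_sum a F t = (\<Sum>k\<in>F. a k * zpow k t)"

lemma fourier_sum_L2: "fourier_sum a F \<in> L2"
  unfolding fourier_sum_def[abs_def] by (intro L2_sum L2_cmult zpow_L2)

lemma cnj_fourier_coeff: "cnj (fourier_coeff g k) = l2_inner (zpow k) g"
  by (simp add: fourier_coeff_def cnj_l2_inner)

lemma l2_inner_fourier_sum:
  assumes "g \<in> L2"
  shows "l2_inner (fourier_sum a F) g = (\<Sum>k\<in>F. a k * cnj (fourier_coeff g k))"
  unfolding fourier_sum_def[abs_def] cnj_fourier_coeff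
  by (subst l2_inner_sum_left) (auto intro: L2_cmult zpow_L2 assms simp: l2_inner_cmult_left)

lemma fourier_coeff_fourier_sum:
  assumes "finite F"
  shows "fourier_coeff (fourier_sum a F) k = (if k \<in> F then a k else 0)"
  using assms unfolding fourier_coeff_def
  by (subst l2_inner_fourier_sum) (auto simp: zpow_L2 cnj_fourier_coeff l2_inner_zpow if_distrib sum.delta cong: if_cong)

lemma l2sq_fourier_sum:
  assumes "finite F"
  shows "l2sq (fourier_sum a F) = (\<Sum>k\<in>F. (cmod (a k))\<^sup>2)"
proof -
  have "complex_of_real (l2sq (fourier_sum a F)) = (\<Sum>k\<in>F. a k * cnj (a k))"
    by (subst l2_inner_self[symmetric], subst l2_inner_fourier_sum)
       (auto simp: fourier_sum_L2 fourier_coeff_fourier_sum assms)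
  also have "\<dots> = complex_of_real (\<Sum>k\<in>F. (cmod (a k))\<^sup>2)"
    by (simp flip: complex_norm_square)
  finally show ?thesis using of_real_eq_iff by blast
qed

text \<open>For the partial sum \<open>s\<close> of \<open>f\<close> over \<open>F\<close>, both
  \<open>l2_inner s f\<close> and \<open>l2sq s\<close> equal the sum \<open>A\<close> on the left.
  Cauchy-Schwarz then reads A^2 \<le> A * \<open>l2sq f\<close>, and \<open>A\<close> is cancelled
  unless it is zero.\<close>

lemma Bessel:
  assumes "f \<in> L2" "finite F"
  shows "(\<Sum>k\<in>F. (cmod (fourier_coeff f k))\<^sup>2) \<le> l2sq f"
proof -
  define s where "s = fourier_sum (fourier_coeff f) F"
  define A where "A = (\<Sum>k\<in>F. (cmod (fourier_coeff f k))\<^sup>2)"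
  have "l2_inner s f = complex_of_real A"
    by (simp add: s_def l2_inner_fourier_sum assms A_def flip: complex_norm_square)
  moreover have "l2sq s = A" by (simp add: s_def A_def l2sq_fourier_sum assms)
  moreover have "A \<ge> 0" by (simp add: A_def sum_nonneg)
  ultimately have "A\<^sup>2 \<le> A * l2sq f"
    using l2_Cauchy_Schwarz[OF fourier_sum_L2 assms(1), of "fourier_coeff f" F] by (simp add: s_def)
  then show ?thesis
    unfolding A_def[symmetric]
    using \<open>A \<ge> 0\<close> l2sq_nonneg[of f] by (cases "A = 0") (auto simp: power2_eq_square)
qed

subsection \<open>Uniqueness of Fourier coefficients\<close>

text \<open>Generation by monomials and sums gives an induction rule under which closure under
  products and vanishing of integrals are checked on monomials.\<close>

inductive_set trigpoly :: "(real^'d::finite \<Rightarrow> complex) set" where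
  monomial: "(\<lambda>t. c * zpow k t) \<in> trigpoly"
| add: "p \<in> trigpoly \<Longrightarrow> q \<in> trigpoly \<Longrightarrow> (\<lambda>t. p t + q t) \<in> trigpoly"

lemma trigpoly_mult:
  assumes "p \<in> trigpoly" "q \<in> trigpoly"
  shows "(\<lambda>t. p t * q t) \<in> trigpoly"
  using assms(1)
proof induction
  case (monomial c k)
  show ?case using assms(2)
  proof induction
    case (monomial c' k')
    show ?case using trigpoly.monomial[of "c * c'" "k + k'"]
      by (simp add: zpow_add mult_ac)
  next
    case (add p q)
    then show ?case using trigpoly.add by (fastforce simp: distrib_left)
  qed
next
  case (add p q')
  then show ?case using trigpoly.add by (fastforce simp: distrib_right)
qed

lemma trigpoly_L2: "p \<in> trigpoly \<Longrightarrow> p \<in> L2"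
  by (induction rule: trigpoly.induct) (auto intro: L2_add L2_cmult zpow_L2)

lemma integral_mult_trigpoly_eq_0:
  assumes "f \<in> L2" "\<And>k. fourier_coeff f k = 0" "p \<in> trigpoly"
  shows "integral\<^sup>L TM (\<lambda>t. f t * p t) = 0"
  using assms(3)
proof induction
  case (monomial c k)
  have "integral\<^sup>L TM (\<lambda>t. f t * (c * zpow k t)) = c * integral\<^sup>L TM (\<lambda>t. f t * zpow k t)"
    by (simp add: mult.left_commute)
  \<comment> \<open>Without conjugation, the integral against \<open>zpow k\<close> is a multiple of
    the coefficient at \<open>-k\<close>.\<close>
  also have "integral\<^sup>L TM (\<lambda>t. f t * zpow k t) = 0"
    using assms(2)[of "-k"] by (simp add: fourier_coeff_def l2_inner_def cnj_zpow)
  finally show ?case by simp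
next
  case (add p q)
  then show ?case
    using L2_integrable_mult[OF assms(1) trigpoly_L2] by (simp add: distrib_left)
qed

text \<open>Trigonometric polynomials do not separate points on opposite faces of the angle box.
  Stone-Weierstrass is therefore applied on the image of the box in complex coordinates, where they
  do.\<close>

definition torus_emb :: "real^'d::finite \<Rightarrow> complex^'d" where
  "torus_emb t = (\<chi> j. cis (t $ j))"

lemma zpow_axis: "zpow (axis j 1) t = cis (t $ j)"
proof -
  have "(\<Sum>i\<in>UNIV. real_of_int (axis j 1 $ i) * t $ i) = (\<Sum>i\<in>UNIV. if i = j then t $ j else 0)"
    by (intro sum.cong) (auto simp: axis_def)
  then show ?thesis by (simp add: zpow_def cis_conv_exp)
qed

lemma continuous_torus_emb: "continuous_on A torus_emb"
  unfolding torus_emb_def[abs_def] cis_conv_exp by (intro continuous_intros)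

lemma compact_torus: "compact (torus_emb ` torus_box)"
  by (intro compact_continuous_image continuous_torus_emb) (simp add: torus_box_def)

lemma sets_TM: "sets TM = sets (restrict_space borel torus_box)"
  by (simp add: TM_def sets_restrict_space)

lemma measurable_comp_torus_emb:
  fixes G :: "complex^'d::finite \<Rightarrow> real"
  assumes "continuous_on (torus_emb ` torus_box) G"
  shows "(\<lambda>t. G (torus_emb t)) \<in> borel_measurable TM"
proof -
  have "continuous_on torus_box (\<lambda>t. G (torus_emb t))"
    using assms by (rule continuous_on_compose2) (auto intro: continuous_torus_emb)
  then have "(\<lambda>t. G (torus_emb t)) \<in> borel_measurable (restrict_space borel torus_box)"
    by (rule borel_measurable_continuous_on_restrict)
  then show ?thesis by (simp add: measurable_cong_sets[OF sets_TM refl])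
qed

text \<open>Stone-Weierstrass for the ring of real continuous functions whose pullback to angles is
  a trigonometric polynomial. Real and imaginary parts of the coordinates belong to it, being
  cosines and sines of the angles, and they separate points.\<close>

lemma torus_approx_trigpoly:
  fixes G :: "complex^'d::finite \<Rightarrow> real"
  assumes "continuous_on (torus_emb ` torus_box) G" "e > 0"
  obtains g where "continuous_on (torus_emb ` torus_box) g"
    "(\<lambda>t. complex_of_real (g (torus_emb t))) \<in> trigpoly"
    "\<And>t. t \<in> torus_box \<Longrightarrow> \<bar>G (torus_emb t) - g (torus_emb t)\<bar> < e"
proof -
  let ?S = "torus_emb ` (torus_box :: (real^'d) set)"
  let ?P = "\<lambda>g. continuous_on ?S g \<and> (\<lambda>t. complex_of_real (g (torus_emb t))) \<in> trigpoly"
  have Re: "?P (\<lambda>z. Re (z $ j))" for j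
  proof
    show "continuous_on ?S (\<lambda>z. Re (z $ j))" by (intro continuous_intros)
    have "(\<lambda>t. (1/2) * zpow (axis j 1) t + (1/2) * zpow (- axis j 1) t) \<in> trigpoly"
      by (intro trigpoly.intros)
    also have "(\<lambda>t. (1/2) * zpow (axis j 1) t + (1/2) * zpow (- axis j 1) t)
      = (\<lambda>t. complex_of_real (Re (torus_emb t $ j)))"
      by (rule ext) (simp add: torus_emb_def zpow_axis complex_eq_iff flip: cnj_zpow)
    finally show "(\<lambda>t. complex_of_real (Re (torus_emb t $ j))) \<in> trigpoly" .
  qed
  have Im: "?P (\<lambda>z. Im (z $ j))" for j
  proof
    show "continuous_on ?S (\<lambda>z. Im (z $ j))" by (intro continuous_intros)
    have "(\<lambda>t. (-\<i>/2) * zpow (axis j 1) t + (\<i>/2) * zpow (- axis j 1) t) \<in> trigpoly"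
      by (intro trigpoly.intros)
    also have "(\<lambda>t. (-\<i>/2) * zpow (axis j 1) t + (\<i>/2) * zpow (- axis j 1) t)
      = (\<lambda>t. complex_of_real (Im (torus_emb t $ j)))"
      by (rule ext) (simp add: torus_emb_def zpow_axis complex_eq_iff flip: cnj_zpow)
    finally show "(\<lambda>t. complex_of_real (Im (torus_emb t $ j))) \<in> trigpoly" .
  qed
  interpret function_ring_on "Collect ?P" ?S
  proof
    show "compact ?S" by (rule compact_torus)
    fix c :: real
    show "(\<lambda>_. c) \<in> Collect ?P" using trigpoly.monomial[of c 0] by simp
  next
    fix x y assume "x \<in> ?S" "y \<in> ?S" "x \<noteq> y"
    then obtain j where "x $ j \<noteq> y $ j" by (auto simp: vec_eq_iff)
    then consider "Re (x $ j) \<noteq> Re (y $ j)" | "Im (x $ j) \<noteq> Im (y $ j)" by (auto simp: complex_eq_iff)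
    then show "\<exists>f\<in>Collect ?P. f x \<noteq> f y"
    proof cases
      case 1
      then show ?thesis using Re[of j] by (intro bexI[of _ "\<lambda>z. Re (z $ j)"]) auto
    next
      case 2
      then show ?thesis using Im[of j] by (intro bexI[of _ "\<lambda>z. Im (z $ j)"]) auto
    qed
  qed (auto intro!: continuous_intros trigpoly.add trigpoly_mult)
  from Stone_Weierstrass_basic[OF assms] that show thesis by auto
qed

text \<open>Replacing \<open>G\<close> by a trigonometric polynomial within \<open>e\<close> changes
  the integral by at most \<open>e\<close> times the L1 norm of \<open>f\<close>, and the integral
  against the polynomial is zero.\<close>

lemma integral_mult_continuous_eq_0:
  fixes G :: "complex^'d::finite \<Rightarrow> real"
  assumes f: "f \<in> L2" "\<And>k. fourier_coeff f k = 0" and G: "continuous_on (torus_emb ` torus_box) G"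
  shows "integral\<^sup>L TM (\<lambda>t. f t * complex_of_real (G (torus_emb t))) = 0"
proof -
  let ?I = "integral\<^sup>L TM (\<lambda>t. f t * complex_of_real (G (torus_emb t)))"
  note [measurable] = L2_measurable[OF f(1)] measurable_comp_torus_emb[OF G]
  have intf: "integrable TM (\<lambda>t. cmod (f t))"
    using L2_integrable[OF f(1)] by simp
  have le: "cmod ?I \<le> e * integral\<^sup>L TM (\<lambda>t. cmod (f t))" if "e > 0" for e
  proof -
    obtain g where g: "continuous_on (torus_emb ` torus_box) g"
      and tp: "(\<lambda>t. complex_of_real (g (torus_emb t))) \<in> trigpoly"
      and e: "\<And>t. t \<in> torus_box \<Longrightarrow> \<bar>G (torus_emb t) - g (torus_emb t)\<bar> < e"
      using torus_approx_trigpoly[OF G \<open>e > 0\<close>] by blast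
    note [measurable] = measurable_comp_torus_emb[OF g]
    let ?d = "\<lambda>t. f t * complex_of_real (G (torus_emb t) - g (torus_emb t))"
    have bd: "cmod (?d t) \<le> e * cmod (f t)" if "t \<in> torus_box" for t
      using mult_left_mono[OF less_imp_le[OF e[OF that]], of "cmod (f t)"]
      by (simp only: norm_mult norm_of_real mult.commute[of e]) simp
    have intd: "integrable TM ?d"
    proof (rule Bochner_Integration.integrable_bound)
      show "integrable TM (\<lambda>t. e * cmod (f t))" using intf by simp
      show "AE t in TM. norm (?d t) \<le> norm (e * cmod (f t))"
        using bd \<open>e > 0\<close> by (intro AE_I2) (auto simp: space_TM)
    qed measurable
    have intg: "integrable TM (\<lambda>t. f t * complex_of_real (g (torus_emb t)))"
      by (rule L2_integrable_mult[OF f(1) trigpoly_L2[OF tp]])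
    have "?I = integral\<^sup>L TM (\<lambda>t. ?d t + f t * complex_of_real (g (torus_emb t)))"
      by (simp add: algebra_simps)
    also have "\<dots> = integral\<^sup>L TM ?d + integral\<^sup>L TM (\<lambda>t. f t * complex_of_real (g (torus_emb t)))"
      by (rule Bochner_Integration.integral_add[OF intd intg])
    also have "\<dots> = integral\<^sup>L TM ?d"
      using integral_mult_trigpoly_eq_0[OF f tp] by simp
    finally have "cmod ?I \<le> integral\<^sup>L TM (\<lambda>t. cmod (?d t))"
      using integral_norm_bound[of TM ?d] by (simp only:)
    also have "\<dots> \<le> integral\<^sup>L TM (\<lambda>t. e * cmod (f t))"
      using intd intf bd by (intro integral_mono) (auto simp: space_TM)
    finally show ?thesis by simp
  qed
  show ?thesis
  proof (rule ccontr)
    assume nz: "?I \<noteq> 0"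
    let ?J = "integral\<^sup>L TM (\<lambda>t. cmod (f t))"
    have J: "?J \<ge> 0" by simp
    then have J1: "?J + 1 > 0" by linarith
    \<comment> \<open>This is the value of \<open>e\<close> that contradicts the bound; adding 1
      keeps the denominator positive even when \<open>?J\<close> is zero.\<close>
    have pos: "cmod ?I / (?J + 1) > 0" using nz by (intro divide_pos_pos J1) simp
    have "cmod ?I \<le> cmod ?I * (?J / (?J + 1))"
      using le[OF pos] by simp
    also have "\<dots> < cmod ?I * 1"
      using nz J1 by (intro mult_strict_left_mono) (simp_all add: pos_divide_less_eq)
    finally show False by simp
  qed
qed

text \<open>The indicator of a closed set is the pointwise limit of continuous cut-offs of the
  distance to it, all bounded by 1, so dominated convergence applies with majorant
  \<open>cmod (f t)\<close>.\<close>

lemma integral_mult_indicator_closed_eq_0: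
  fixes K :: "(complex^'d::finite) set"
  assumes f: "f \<in> L2" "\<And>k. fourier_coeff f k = 0" and K: "closed K"
  shows "integral\<^sup>L TM (\<lambda>t. f t * indicator K (torus_emb t)) = 0"
proof (cases "K = {}")
  \<comment> \<open>The empty set is treated apart because \<open>infdist\<close> to it is 0 by
    convention, which would make every \<open>G n\<close> equal to 1.\<close>
  case False
  define G where "G n z = max 0 (1 - real n * infdist z K)" for n :: nat and z :: "complex^'d"
  have G: "continuous_on A (G n)" for A n
    unfolding G_def[abs_def] by (intro continuous_intros)
  have lim: "(\<lambda>n. G n z) \<longlonglongrightarrow> indicator K z" for z
  proof (cases "z \<in> K")
    case True
    then show ?thesis by (simp add: G_def)
  next
    case z: False
    then have pos: "infdist z K > 0"
      using K False by (metis in_closed_iff_infdist_zero infdist_nonneg order_le_less)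
    obtain N where N: "1 / infdist z K < real N" using reals_Archimedean2 by blast
    have "G n z = 0" if "n \<ge> N" for n
    proof -
      have "1 < real N * infdist z K" using N pos by (simp add: field_simps)
      also have "\<dots> \<le> real n * infdist z K" using that pos by (intro mult_right_mono) auto
      finally show ?thesis by (simp add: G_def)
    qed
    then have "eventually (\<lambda>n. G n z = 0) sequentially"
      by (auto simp: eventually_sequentially)
    then show ?thesis using z by (simp add: tendsto_eventually)
  qed
  note [measurable] = L2_measurable[OF f(1)] measurable_comp_torus_emb[OF G]
  have [measurable]: "(\<lambda>t. indicator K (torus_emb t) :: complex) \<in> borel_measurable TM"
  proof -
    have [measurable]: "torus_emb \<in> borel_measurable borel"
      by (intro borel_measurable_continuous_onI continuous_torus_emb)
    have [measurable]: "K \<in> sets borel" using K by auto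
    show ?thesis by measurable
  qed
  have "(\<lambda>n. integral\<^sup>L TM (\<lambda>t. f t * complex_of_real (G n (torus_emb t))))
    \<longlonglongrightarrow> integral\<^sup>L TM (\<lambda>t. f t * indicator K (torus_emb t))"
  proof (rule integral_dominated_convergence[where w = "\<lambda>t. cmod (f t)"])
    show "integrable TM (\<lambda>t. cmod (f t))" using L2_integrable[OF f(1)] by simp
    have "(\<lambda>n. complex_of_real (G n z)) \<longlonglongrightarrow> indicator K z" for z
      using tendsto_of_real[OF lim[of z], where 'a = complex] by (cases "z \<in> K") auto
    then show "AE t in TM. (\<lambda>n. f t * complex_of_real (G n (torus_emb t)))
      \<longlonglongrightarrow> f t * indicator K (torus_emb t)"
      by (intro AE_I2 tendsto_intros)
    have "\<bar>G n z\<bar> \<le> 1" for n z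
      using infdist_nonneg[of z K] by (simp add: G_def)
    then show "AE t in TM. norm (f t * complex_of_real (G n (torus_emb t))) \<le> cmod (f t)" for n
      by (auto simp: norm_mult intro!: mult_left_le)
  qed measurable
  moreover have "integral\<^sup>L TM (\<lambda>t. f t * complex_of_real (G n (torus_emb t))) = 0" for n
    by (rule integral_mult_continuous_eq_0[OF f G])
  ultimately show ?thesis
    by (simp add: LIMSEQ_const_iff)
qed simp

text \<open>Coordinates of \<open>t\<close> and \<open>s\<close> differ by a multiple of 2 pi and by
  strictly less than 2 pi. Strictness comes from \<open>t\<close> being interior, so
  \<open>s\<close> may lie on the boundary: an interior point is not identified with any other point
  of the box.\<close>

lemma torus_emb_inj:
  assumes "t \<in> box 0 (\<chi> j. 2 * pi)" "s \<in> torus_box" "torus_emb t = torus_emb s"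
  shows "t = s"
proof -
  have "t $ j = s $ j" for j
  proof -
    have t: "0 < t $ j" "t $ j < 2 * pi" using assms(1) by (auto simp: mem_box_cart)
    have s: "0 \<le> s $ j" "s $ j \<le> 2 * pi" using assms(2) by (auto simp: torus_box_def mem_box_cart)
    have "cis (t $ j) = cis (s $ j)"
      using assms(3) by (simp add: torus_emb_def vec_eq_iff)
    then have "exp (\<i> * t $ j) = exp (\<i> * s $ j)" by (simp add: cis_conv_exp)
    then obtain n :: int where "\<i> * t $ j = \<i> * s $ j + (of_int (2 * n) * pi) * \<i>"
      unfolding exp_eq by blast
    then have n: "t $ j = s $ j + 2 * of_int n * pi" by (simp add: complex_eq_iff)
    have "\<bar>real_of_int n\<bar> * (2 * pi) = \<bar>t $ j - s $ j\<bar>"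
      using n by (simp add: abs_mult)
    also have "\<dots> < 1 * (2 * pi)" using s t by linarith
    finally have "\<bar>real_of_int n\<bar> * (2 * pi) < 1 * (2 * pi)" .
    then have "\<bar>real_of_int n\<bar> < 1" by (rule mult_right_less_imp_less) auto
    then have "n = 0" by linarith
    then show ?thesis using n by simp
  qed
  then show ?thesis by (simp add: vec_eq_iff)
qed

lemma AE_torus_box_interior: "AE t in lborel. t \<in> torus_box \<longrightarrow> t \<in> box (0::real^'d::finite) (\<chi> j. 2 * pi)"
proof -
  have "torus_box - box 0 (\<chi> j. 2 * pi) \<in> null_sets (lborel :: (real^'d) measure)"
    using negligible_frontier_interval[of "0::real^'d" "\<chi> j. 2 * pi"]
    by (auto simp: negligible_iff_null_sets null_sets_completion_iff torus_box_def)
  from AE_not_in[OF this] show ?thesis by eventually_elim auto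
qed

text \<open>Extended by zero to \<open>g\<close>, the function has vanishing integral over every
  open set, hence over every Borel set by a Dynkin-system argument, and a density with this property
  is zero almost everywhere.\<close>

lemma fourier_coeff_zero_imp_AE_zero:
  fixes f :: "real^'d::finite \<Rightarrow> complex"
  assumes f: "f \<in> L2" "\<And>k. fourier_coeff f k = 0"
  shows "AE t in TM. f t = 0"
proof -
  define g where "g t = indicator torus_box t *\<^sub>R f t" for t
  have intg: "integrable lborel g"
    using L2_integrable[OF f(1)] unfolding g_def[abs_def] TM_def by (subst (asm) integrable_restrict_space) auto
  then have [measurable]: "g \<in> borel_measurable borel" by auto
  have setint: "set_integrable lborel A g" if "A \<in> sets borel" for A
    unfolding set_integrable_def using that intg by (intro integrable_mult_indicator) auto
  have int0: "integral\<^sup>L lborel g = 0"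
  proof -
    have "integral\<^sup>L lborel g = integral\<^sup>L TM f"
      unfolding g_def[abs_def] TM_def by (subst integral_restrict_space) auto
    also have "\<dots> = 0"
      using f(2)[of 0] by (simp add: fourier_coeff_def l2_inner_def)
    finally show ?thesis .
  qed
  have opn: "set_lebesgue_integral lborel U g = 0" if "open U" for U
  proof -
    \<comment> \<open>\<open>torus_emb\<close> identifies opposite faces of the box, so \<open>U\<close> is first cut down to the interior.\<close>
    define V where "V = U \<inter> box 0 (\<chi> j. 2 * pi)"
    have "open V" using that by (auto simp: V_def)
    then have [measurable]: "V \<in> sets borel" "U \<in> sets borel" using that by auto
    \<comment> \<open>\<open>K\<close> is closed as a compact image, and by injectivity on the
      interior its preimage in the box is exactly the complement of \<open>V\<close>. Integrals over
      \<open>V\<close> are thus reached through a closed set and the total integral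
      \<open>int0\<close>.\<close>
    define K where "K = torus_emb ` (torus_box - V)"
    have "compact K"
      unfolding K_def using \<open>open V\<close>
      by (intro compact_continuous_image continuous_torus_emb compact_diff) (auto simp: torus_box_def)
    then have "closed K" by (rule compact_imp_closed)
    have ind: "indicator K (torus_emb t) = (indicator (- V) t :: complex)" if "t \<in> torus_box" for t
    proof -
      have "torus_emb t \<in> K \<longleftrightarrow> t \<notin> V"
        using that torus_emb_inj[of t] by (auto simp: K_def V_def)
      then show ?thesis by (auto simp: indicator_def)
    qed
    have "0 = integral\<^sup>L TM (\<lambda>t. f t * indicator K (torus_emb t))"
      using integral_mult_indicator_closed_eq_0[OF f \<open>closed K\<close>] by simp
    also have "\<dots> = (LBINT t. indicator torus_box t *\<^sub>R (f t * indicator K (torus_emb t)))"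
      unfolding TM_def by (subst integral_restrict_space) auto
    also have "\<dots> = (LBINT t. g t - indicator V t *\<^sub>R g t)"
    proof (rule Bochner_Integration.integral_cong)
      fix t
      show "indicator torus_box t *\<^sub>R (f t * indicator K (torus_emb t)) = g t - indicator V t *\<^sub>R g t"
        by (cases "t \<in> torus_box"; cases "t \<in> V") (simp_all add: g_def ind)
    qed simp
    also have "\<dots> = - set_lebesgue_integral lborel V g"
      using setint[of V] intg int0 by (simp add: set_lebesgue_integral_def set_integrable_def)
    finally have "set_lebesgue_integral lborel V g = 0" by simp
    \<comment> \<open>Passing from \<open>V\<close> back to \<open>U\<close> costs nothing:
      \<open>g\<close> vanishes outside the box, and the boundary of the box is a null set.\<close>
    moreover have "set_lebesgue_integral lborel V g = set_lebesgue_integral lborel U g"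
      unfolding set_lebesgue_integral_def
    proof (rule integral_cong_AE)
      show "AE t in lborel. indicator V t *\<^sub>R g t = indicator U t *\<^sub>R g t"
        using AE_torus_box_interior by eventually_elim (simp add: V_def g_def indicator_def)
    qed measurable
    ultimately show ?thesis by simp
  qed
  have all: "set_lebesgue_integral lborel A g = 0" if "A \<in> sets borel" for A
  proof -
    \<comment> \<open>Open sets form an intersection-stable generator of the Borel sets, so only
      complements and countable disjoint unions remain to be checked; complements use that the total
      integral is zero.\<close>
    have "Int_stable {S :: (real^'d) set. open S}" by (auto simp: Int_stable_def)
    moreover have "{S :: (real^'d) set. open S} \<subseteq> Pow UNIV" by auto
    moreover from that have "A \<in> sigma_sets UNIV {S. open S}" by (simp add: borel_def)
    ultimately show ?thesis
    proof (induction rule: sigma_sets_induct_disjoint)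
      case (compl A)
      then have A: "A \<in> sets borel" by (simp add: borel_def)
      have "set_lebesgue_integral lborel (UNIV - A) g = (LBINT t. g t - indicator A t *\<^sub>R g t)"
        unfolding set_lebesgue_integral_def
        by (intro Bochner_Integration.integral_cong) (auto simp: indicator_def)
      also have "\<dots> = - set_lebesgue_integral lborel A g"
        using setint[OF A] intg int0 by (simp add: set_lebesgue_integral_def set_integrable_def)
      finally show ?case using compl by simp
    next
      case (union A)
      then have A: "A i \<in> sets borel" for i by (auto simp: borel_def)
      have "set_lebesgue_integral lborel (\<Union>i. A i) g = (\<Sum>i. set_lebesgue_integral lborel (A i) g)"
        using union(1) A setint by (intro lebesgue_integral_countable_add) (auto simp: disjoint_family_on_def)
      then show ?case using union by simp
    qed (auto intro: opn)
  qed
  have "AE t in lborel. g t = 0"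
    using all by (intro sigma_finite_measure.density_zero[OF sigma_finite_lborel] intg) auto
  then show ?thesis
    unfolding TM_def by (subst AE_restrict_space_iff) (auto simp: g_def elim!: eventually_mono)
qed

subsection \<open>Riesz--Fischer and Parseval\<close>

text \<open>An increasing exhaustion of a countable index type by finite sets, which turns series
  over multi-indices into limits of ordinary sequences.\<close>

definition initial_segment :: "nat \<Rightarrow> 'a::countable set" where
  "initial_segment n = {k. to_nat k < n}"

lemma finite_initial_segment [simp]: "finite (initial_segment n)"
proof (rule inj_on_finite)
  show "inj_on to_nat (initial_segment n)" by (rule inj_on_subset[OF inj_to_nat]) auto
  show "to_nat ` initial_segment n \<subseteq> {..<n}" by (auto simp: initial_segment_def)
qed auto

lemma initial_segment_mono: "m \<le> n \<Longrightarrow> initial_segment m \<subseteq> initial_segment n"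
  by (auto simp: initial_segment_def)

lemma eventually_in_initial_segment: "\<forall>\<^sub>F n in sequentially. k \<in> initial_segment n"
  using eventually_gt_at_top[of "to_nat k"] by (simp add: initial_segment_def)

text \<open>The partial sums are Cauchy in L2, hence in L1, so a subsequence converges almost
  everywhere; Fatou's lemma shows that its limit is also the L2 limit of the full sequence. The last
  conclusion, convergence of inner products, is recorded because it becomes Parseval's
  identity.\<close>

lemma Riesz_Fischer:
  fixes a :: "int^'d::finite \<Rightarrow> complex"
  assumes B: "\<And>F. finite F \<Longrightarrow> (\<Sum>k\<in>F. (cmod (a k))\<^sup>2) \<le> B"
  obtains h where "h \<in> L2" "\<And>k. fourier_coeff h k = a k"
    "\<And>g. g \<in> L2 \<Longrightarrow> (\<lambda>n. \<Sum>k\<in>initial_segment n. a k * cnj (fourier_coeff g k)) \<longlonglongrightarrow> l2_inner h g"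
proof -
  define c where "c = (2 * pi) ^ CARD('d)"
  have c: "c > 0" by (simp add: c_def)
  have c_l2sq: "integral\<^sup>L TM (\<lambda>t. (cmod (f t))\<^sup>2) = c * l2sq f" for f :: "real^'d \<Rightarrow> complex"
    by (simp add: l2sq_def c_def)
  define s where "s n = fourier_sum a (initial_segment n)" for n
  define A where "A n = (\<Sum>k\<in>initial_segment n. (cmod (a k))\<^sup>2)" for n
  have sL2: "s n \<in> L2" for n by (simp add: s_def fourier_sum_L2)
  note [measurable] = L2_measurable[OF sL2]
  have incA: "incseq A"
    unfolding A_def incseq_def by (auto intro!: sum_mono2 dest: initial_segment_mono)
  obtain L where L: "A \<longlonglongrightarrow> L" and AL: "\<And>n. A n \<le> L"
    using incseq_convergent[OF incA, of B] B by (auto simp: A_def)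
  have sq: "l2sq (\<lambda>t. s j t - s i t) = A j - A i" if "i \<le> j" for i j
  proof -
    have sub: "initial_segment i \<subseteq> (initial_segment j :: (int^'d) set)" by (rule initial_segment_mono[OF that])
    \<comment> \<open>A difference of partial sums is again a finite Fourier sum, over the
      difference of the index sets, so its norm is read off from the coefficients.\<close>
    have "(\<lambda>t. s j t - s i t) = fourier_sum a (initial_segment j - initial_segment i)"
      using sub by (auto simp: s_def fourier_sum_def sum_diff)
    then show ?thesis using sub by (simp add: l2sq_fourier_sum A_def sum_diff)
  qed
  have sqle: "l2sq (\<lambda>t. s j t - s i t) \<le> L - A i" if "i \<le> j" for i j
    using sq[OF that] AL[of j] by simp
  \<comment> \<open>Cauchy-Schwarz for the modulus of \<open>f\<close> against the constant function
    \<open>zpow 0\<close>, whose normalised norm is 1; the factor \<open>c\<close> undoes the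
    normalisation.\<close>
  have L1: "(integral\<^sup>L TM (\<lambda>t. cmod (f t)))\<^sup>2 \<le> c\<^sup>2 * l2sq f" if "f \<in> L2" for f :: "real^'d \<Rightarrow> complex"
  proof -
    let ?f = "\<lambda>t. complex_of_real (cmod (f t))"
    note [measurable] = L2_measurable[OF that]
    have "?f \<in> L2" using that by (auto simp: L2_def)
    moreover have "l2_inner ?f (zpow 0) = complex_of_real (integral\<^sup>L TM (\<lambda>t. cmod (f t)) / c)"
      by (simp add: l2_inner_def c_def)
    moreover have "l2sq (zpow (0 :: int^'d)) = 1"
      using l2_inner_self[of "zpow (0 :: int^'d)"] l2_inner_zpow[of "0 :: int^'d" 0] by simp
    moreover have "l2sq ?f = l2sq f" by (simp add: l2sq_def)
    ultimately have "(integral\<^sup>L TM (\<lambda>t. cmod (f t)) / c)\<^sup>2 \<le> l2sq f"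
      using l2_Cauchy_Schwarz[of ?f "zpow 0", OF _ zpow_L2] by (simp only: norm_of_real power2_abs mult_1_right)
    then show ?thesis using c by (simp add: power_divide pos_divide_le_eq mult.commute)
  qed
  have cau: "\<exists>N. \<forall>i\<ge>N. \<forall>j\<ge>N. integral\<^sup>L TM (\<lambda>t. cmod (s i t - s j t)) < e" if "e > 0" for e
  proof -
    \<comment> \<open>The threshold is chosen so that the bound c^2 * (L - A i) on the squared L1
      distance falls below e^2.\<close>
    have "eventually (\<lambda>n. L - A n < (e / c)\<^sup>2) sequentially"
      using tendsto_diff[OF tendsto_const[of L] L] that c by (intro order_tendstoD) auto
    then obtain N where N: "\<And>n. n \<ge> N \<Longrightarrow> L - A n < (e / c)\<^sup>2" by (auto simp: eventually_sequentially)
    have *: "integral\<^sup>L TM (\<lambda>t. cmod (s j t - s i t)) < e" if "i \<ge> N" "i \<le> j" for i j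
    proof -
      have "(integral\<^sup>L TM (\<lambda>t. cmod (s j t - s i t)))\<^sup>2 \<le> c\<^sup>2 * (L - A i)"
        using L1[OF L2_diff[OF sL2 sL2], of j i] sqle[OF that(2)] c
        by (meson mult_left_mono order_trans zero_le_power2)
      also have "\<dots> < c\<^sup>2 * (e / c)\<^sup>2"
        using N[OF that(1)] c by (intro mult_strict_left_mono) auto
      also have "\<dots> = e\<^sup>2" using c by (simp add: power_divide)
      finally show ?thesis using \<open>e > 0\<close> by (auto intro: power_less_imp_less_base)
    qed
    show ?thesis
    proof (intro exI[of _ N] allI impI)
      fix i j assume "i \<ge> N" "j \<ge> N"
      then show "integral\<^sup>L TM (\<lambda>t. cmod (s i t - s j t)) < e"
        using *[of i j] *[of j i] by (cases "i \<le> j") (auto simp: norm_minus_commute)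
    qed
  qed
  obtain r where r: "strict_mono r" and C: "AE t in TM. Cauchy (\<lambda>i. s (r i) t)"
    by (rule cauchy_L1_AE_cauchy_subseq[OF L2_integrable[OF sL2] cau])
  \<comment> \<open>Where the subsequence fails to converge, \<open>lim\<close> is an arbitrary
    value; this happens only on a null set.\<close>
  define h where "h t = lim (\<lambda>i. s (r i) t)" for t
  have [measurable]: "h \<in> borel_measurable TM"
    unfolding h_def[abs_def] by measurable
  have lim: "AE t in TM. (\<lambda>i. s (r i) t) \<longlonglongrightarrow> h t"
    using C by eventually_elim (simp add: h_def Cauchy_convergent_iff convergent_LIMSEQ_iff)
  \<comment> \<open>Fatou's lemma along the subsequence with \<open>n\<close> fixed; from some index
    on \<open>r i\<close> exceeds or equals \<open>n\<close>, so \<open>sqle\<close> bounds every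
    integral.\<close>
  have fatou: "(\<integral>\<^sup>+t. ennreal ((cmod (h t - s n t))\<^sup>2) \<partial>TM) \<le> ennreal (c * (L - A n))" for n
  proof -
    have "(\<integral>\<^sup>+t. ennreal ((cmod (h t - s n t))\<^sup>2) \<partial>TM)
       = (\<integral>\<^sup>+t. liminf (\<lambda>i. ennreal ((cmod (s (r i) t - s n t))\<^sup>2)) \<partial>TM)"
    proof (rule nn_integral_cong_AE, use lim in eventually_elim)
      fix t assume "(\<lambda>i. s (r i) t) \<longlonglongrightarrow> h t"
      then have "(\<lambda>i. ennreal ((cmod (s (r i) t - s n t))\<^sup>2)) \<longlonglongrightarrow> ennreal ((cmod (h t - s n t))\<^sup>2)"
        by (intro tendsto_intros tendsto_ennrealI)
      then show "ennreal ((cmod (h t - s n t))\<^sup>2) = liminf (\<lambda>i. ennreal ((cmod (s (r i) t - s n t))\<^sup>2))"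
        by (intro lim_imp_Liminf[symmetric]) auto
    qed
    also have "\<dots> \<le> liminf (\<lambda>i. \<integral>\<^sup>+t. ennreal ((cmod (s (r i) t - s n t))\<^sup>2) \<partial>TM)"
      by (rule nn_integral_liminf) measurable
    also have "\<dots> \<le> ennreal (c * (L - A n))"
    proof (rule Liminf_le)
      show "\<forall>\<^sub>F i in sequentially. (\<integral>\<^sup>+t. ennreal ((cmod (s (r i) t - s n t))\<^sup>2) \<partial>TM) \<le> ennreal (c * (L - A n))"
        using eventually_ge_at_top[of n]
      proof eventually_elim
        case (elim i)
        then have "n \<le> r i" using seq_suble[OF r, of i] by linarith
        then have "c * l2sq (\<lambda>t. s (r i) t - s n t) \<le> c * (L - A n)"
          using sqle c by (intro mult_left_mono) auto
        then show ?case
          using L2_integrable_sq[OF L2_diff[OF sL2 sL2], of "r i" n] c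
          by (simp add: nn_integral_eq_integral c_l2sq ennreal_leI)
      qed
    qed simp
    finally show ?thesis .
  qed
  have diffL2: "(\<lambda>t. h t - s n t) \<in> L2" for n
  proof -
    have "(\<integral>\<^sup>+t. ennreal ((cmod (h t - s n t))\<^sup>2) \<partial>TM) < \<infinity>"
      using fatou[of n] ennreal_less_top[of "c * (L - A n)"]
      unfolding infinity_ennreal_def by (rule le_less_trans)
    then have "integrable TM (\<lambda>t. (cmod (h t - s n t))\<^sup>2)"
      by (intro integrableI_nonneg) auto
    then show ?thesis by (simp add: L2_def)
  qed
  have hL2: "h \<in> L2" using L2_add[OF diffL2[of 0] sL2[of 0]] by simp
  have hsq: "l2sq (\<lambda>t. h t - s n t) \<le> L - A n" for n
  proof -
    have "c * l2sq (\<lambda>t. h t - s n t) \<le> c * (L - A n)"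
    proof -
      have "ennreal (c * l2sq (\<lambda>t. h t - s n t)) \<le> ennreal (c * (L - A n))"
        using fatou[of n] nn_integral_eq_integral[OF L2_integrable_sq[OF diffL2[of n]]]
        by (simp add: c_l2sq)
      then show ?thesis using AL[of n] c by (subst (asm) ennreal_le_iff) auto
    qed
    then show ?thesis using c by simp
  qed
  have conv: "(\<lambda>n. l2_inner (s n) g) \<longlonglongrightarrow> l2_inner h g" if g: "g \<in> L2" for g
  proof -
    have "(\<lambda>n. (cmod (l2_inner (s n) g - l2_inner h g))\<^sup>2) \<longlonglongrightarrow> 0"
    proof (rule tendsto_sandwich[where f = "\<lambda>_. 0"])
      show "(\<lambda>n. (L - A n) * l2sq g) \<longlonglongrightarrow> 0"
        using tendsto_mult_right[OF tendsto_diff[OF tendsto_const[of L] L], of "l2sq g"] by simp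
      have "(cmod (l2_inner (s n) g - l2_inner h g))\<^sup>2 \<le> (L - A n) * l2sq g" for n
      proof -
        have "(cmod (l2_inner (s n) g - l2_inner h g))\<^sup>2 = (cmod (l2_inner (\<lambda>t. h t - s n t) g))\<^sup>2"
          by (simp add: l2_inner_diff_left hL2 sL2 g norm_minus_commute)
        also have "\<dots> \<le> l2sq (\<lambda>t. h t - s n t) * l2sq g"
          by (rule l2_Cauchy_Schwarz[OF diffL2 g])
        also have "\<dots> \<le> (L - A n) * l2sq g"
          by (intro mult_right_mono hsq l2sq_nonneg)
        finally show ?thesis .
      qed
      then show "\<forall>\<^sub>F n in sequentially. (cmod (l2_inner (s n) g - l2_inner h g))\<^sup>2 \<le> (L - A n) * l2sq g"
        by simp
    qed auto
    from tendsto_real_sqrt[OF this]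
    have "(\<lambda>n. cmod (l2_inner (s n) g - l2_inner h g)) \<longlonglongrightarrow> 0" by simp
    then have "(\<lambda>n. l2_inner (s n) g - l2_inner h g) \<longlonglongrightarrow> 0" by (rule tendsto_norm_zero_cancel)
    then show ?thesis by (rule LIM_zero_cancel)
  qed
  show thesis
  proof (rule that[OF hL2])
    show "fourier_coeff h k = a k" for k
    proof -
      have "(\<lambda>n. fourier_coeff (s n) k) \<longlonglongrightarrow> fourier_coeff h k"
        unfolding fourier_coeff_def by (rule conv[OF zpow_L2])
      moreover have "(\<lambda>n. fourier_coeff (s n) k) \<longlonglongrightarrow> a k"
        by (rule tendsto_eventually, use eventually_in_initial_segment[of k] in eventually_elim)
           (simp add: s_def fourier_coeff_fourier_sum)
      ultimately show ?thesis by (rule LIMSEQ_unique)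
    qed
    show "(\<lambda>n. \<Sum>k\<in>initial_segment n. a k * cnj (fourier_coeff g k)) \<longlonglongrightarrow> l2_inner h g" if "g \<in> L2" for g
      using conv[OF that] that by (simp add: s_def l2_inner_fourier_sum)
  qed
qed

subsection \<open>Toeplitz operators on the Hardy space\<close>

lemma fourier_coeff_diff:
  "f \<in> L2 \<Longrightarrow> g \<in> L2 \<Longrightarrow> fourier_coeff (\<lambda>t. f t - g t) k = fourier_coeff f k - fourier_coeff g k"
  by (simp add: fourier_coeff_def l2_inner_diff_left zpow_L2)

lemma fourier_coeff_cong_imp_AE_eq:
  assumes "f \<in> L2" "g \<in> L2" "\<And>k. fourier_coeff f k = fourier_coeff g k"
  shows "AE t in TM. f t = g t"
  using fourier_coeff_zero_imp_AE_zero[OF L2_diff[OF assms(1,2)]] assms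
  by (simp add: fourier_coeff_diff)

text \<open>Bessel's inequality lets Riesz-Fischer build a function from the coefficients of
  \<open>f\<close>. By uniqueness it equals \<open>f\<close> almost everywhere, so its convergence
  statement holds for \<open>f\<close> itself.\<close>

lemma Parseval:
  assumes "f \<in> L2" "g \<in> L2"
  shows "(\<lambda>n. \<Sum>k\<in>initial_segment n. fourier_coeff f k * cnj (fourier_coeff g k)) \<longlonglongrightarrow> l2_inner f g"
proof -
  obtain h where h: "h \<in> L2" "\<And>k. fourier_coeff h k = fourier_coeff f k"
    and lim: "\<And>g. g \<in> L2 \<Longrightarrow>
      (\<lambda>n. \<Sum>k\<in>initial_segment n. fourier_coeff f k * cnj (fourier_coeff g k)) \<longlonglongrightarrow> l2_inner h g"
    using Riesz_Fischer[OF Bessel[OF assms(1)]] by blast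
  have "AE t in TM. h t = f t"
    using h assms by (intro fourier_coeff_cong_imp_AE_eq) auto
  then have "l2_inner h g = l2_inner f g"
    by (intro l2_inner_AE_cong_left h assms)
  then show ?thesis using lim[OF assms(2)] by simp
qed

section \<open>Membership in the Hardy space and equality through coefficients\<close>

lemma H2_L2: "f \<in> H2 \<Longrightarrow> f \<in> L2"
  by (simp add: H2_def)

lemma H2_fourier_coeff: "f \<in> H2 \<Longrightarrow> \<not> (\<forall>j. 0 \<le> k $ j) \<Longrightarrow> fourier_coeff f k = 0"
  by (auto simp: H2_def not_le)

lemma H2I: "f \<in> L2 \<Longrightarrow> (\<And>k. \<not> (\<forall>j. 0 \<le> k $ j) \<Longrightarrow> fourier_coeff f k = 0) \<Longrightarrow> f \<in> H2"
  by (auto simp: H2_def not_le)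

lemma fourier_coeff_cmult_zpow: "fourier_coeff (\<lambda>t. c * zpow m t) k = (if k = m then c else 0)"
  by (simp add: fourier_coeff_def l2_inner_cmult_left l2_inner_zpow)

lemma cmult_zpow_H2: "(\<forall>j. 0 \<le> m $ j) \<Longrightarrow> (\<lambda>t. c * zpow m t) \<in> H2"
  by (rule H2I) (auto simp: L2_cmult zpow_L2 fourier_coeff_cmult_zpow)

lemma zpow_H2: "(\<forall>j. 0 \<le> m $ j) \<Longrightarrow> zpow m \<in> H2"
  using cmult_zpow_H2[of m 1] by simp

text \<open>Outside the nonnegative cone both coefficients vanish, so uniqueness needs only the
  indices in the cone. This translates the almost everywhere equality in \<open>C_symmetric\<close>
  into coefficients.\<close>

lemma H2_AE_eq_iff:
  assumes "f \<in> H2" "g \<in> H2"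
  shows "(AE t in TM. f t = g t) \<longleftrightarrow> (\<forall>k. (\<forall>j. 0 \<le> k $ j) \<longrightarrow> fourier_coeff f k = fourier_coeff g k)"
proof
  assume "AE t in TM. f t = g t"
  then show "\<forall>k. (\<forall>j. 0 \<le> k $ j) \<longrightarrow> fourier_coeff f k = fourier_coeff g k"
    unfolding fourier_coeff_def using assms by (blast intro: l2_inner_AE_cong_left H2_L2 zpow_L2)
next
  assume "\<forall>k. (\<forall>j. 0 \<le> k $ j) \<longrightarrow> fourier_coeff f k = fourier_coeff g k"
  then have "fourier_coeff f k = fourier_coeff g k" for k
    using H2_fourier_coeff assms by metis
  then show "AE t in TM. f t = g t"
    using assms by (intro fourier_coeff_cong_imp_AE_eq H2_L2)
qed

text \<open>Common source of witnesses for the projection and the conjugation: domination by the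
  coefficients of an L2 function makes \<open>a\<close>, cut off outside the cone, square summable
  by Bessel.\<close>

lemma H2_ex_fourier_coeff:
  fixes a :: "int^'d::finite \<Rightarrow> complex"
  assumes "f \<in> L2" "\<And>k. cmod (a k) \<le> cmod (fourier_coeff f k)"
  shows "\<exists>h\<in>H2. \<forall>k. (\<forall>j. 0 \<le> k $ j) \<longrightarrow> fourier_coeff h k = a k"
proof -
  define b where "b k = (if \<forall>j. 0 \<le> k $ j then a k else 0)" for k
  have bound: "(\<Sum>k\<in>F. (cmod (b k))\<^sup>2) \<le> l2sq f" if "finite F" for F
  proof -
    have "(\<Sum>k\<in>F. (cmod (b k))\<^sup>2) \<le> (\<Sum>k\<in>F. (cmod (fourier_coeff f k))\<^sup>2)"
      using assms(2) by (intro sum_mono power_mono) (auto simp: b_def)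
    also have "\<dots> \<le> l2sq f" by (rule Bessel[OF assms(1) that])
    finally show ?thesis .
  qed
  show ?thesis
  proof (rule Riesz_Fischer[OF bound])
    fix h assume h: "h \<in> L2" "\<And>k. fourier_coeff h k = b k"
    have "h \<in> H2" by (rule H2I[OF h(1)]) (auto simp: h(2) b_def)
    moreover have "\<forall>k. (\<forall>j. 0 \<le> k $ j) \<longrightarrow> fourier_coeff h k = a k"
      by (simp add: h(2) b_def)
    ultimately show ?thesis by blast
  qed
qed

text \<open>The witness \<open>h\<close> keeps the coefficients of \<open>g\<close> on the cone.
  Then \<open>g - h\<close> has coefficients only off the cone and \<open>u\<close> only on it, so
  every term of the Parseval series is zero.\<close>

lemma P_H2_characterization:
  assumes "g \<in> L2"
  shows "P_H2 g \<in> H2 \<and> (\<forall>u\<in>H2. l2_inner (\<lambda>t. g t - P_H2 g t) u = 0)"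
proof -
  obtain h where h: "h \<in> H2" "\<And>k. (\<forall>j. 0 \<le> k $ j) \<Longrightarrow> fourier_coeff h k = fourier_coeff g k"
    using H2_ex_fourier_coeff[OF assms order_refl] by blast
  have "l2_inner (\<lambda>t. g t - h t) u = 0" if u: "u \<in> H2" for u
  proof -
    have d: "(\<lambda>t. g t - h t) \<in> L2" using L2_diff[OF assms H2_L2[OF h(1)]] .
    have z: "fourier_coeff (\<lambda>t. g t - h t) k * cnj (fourier_coeff u k) = 0" for k
      using h(2)[of k] H2_fourier_coeff[OF u, of k] assms H2_L2[OF h(1)]
      by (cases "\<forall>j. 0 \<le> k $ j") (simp_all add: fourier_coeff_diff)
    have "(\<lambda>n. 0) \<longlonglongrightarrow> l2_inner (\<lambda>t. g t - h t) u"
      using Parseval[OF d H2_L2[OF u]] unfolding z by simp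
    then show ?thesis by (simp add: LIMSEQ_const_iff)
  qed
  with h(1) have "\<exists>h. h \<in> H2 \<and> (\<forall>u\<in>H2. l2_inner (\<lambda>t. g t - h t) u = 0)" by blast
  then show ?thesis unfolding P_H2_def by (rule someI_ex)
qed

lemma P_H2_in_H2: "g \<in> L2 \<Longrightarrow> P_H2 g \<in> H2"
  using P_H2_characterization by blast

lemma l2_inner_P_H2: "g \<in> L2 \<Longrightarrow> u \<in> H2 \<Longrightarrow> l2_inner (P_H2 g) u = l2_inner g u"
  using P_H2_characterization[of g] l2_inner_diff_left[of g "P_H2 g" u] by (simp add: H2_L2)

section \<open>Toeplitz operators, their adjoints and the conjugation\<close>

lemma toeplitz_in_H2: "\<phi> \<in> Linf \<Longrightarrow> f \<in> H2 \<Longrightarrow> toeplitz \<phi> f \<in> H2"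
  unfolding toeplitz_def by (intro P_H2_in_H2 Linf_mult_L2 H2_L2)

lemma l2_inner_toeplitz:
  "\<phi> \<in> Linf \<Longrightarrow> f \<in> H2 \<Longrightarrow> u \<in> H2 \<Longrightarrow> l2_inner (toeplitz \<phi> f) u = l2_inner (\<lambda>t. \<phi> t * f t) u"
  unfolding toeplitz_def by (intro l2_inner_P_H2 Linf_mult_L2 H2_L2)

text \<open>The witness is the Toeplitz operator with the conjugate symbol, applied to
  \<open>u\<close>: multiplication by \<phi> moves across the inner product as multiplication by its
  conjugate.\<close>

lemma h2_adjoint_toeplitz_characterization:
  assumes "\<phi> \<in> Linf" "u \<in> H2"
  shows "h2_adjoint (toeplitz \<phi>) u \<in> H2 \<and>
    (\<forall>f\<in>H2. l2_inner (toeplitz \<phi> f) u = l2_inner f (h2_adjoint (toeplitz \<phi>) u))"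
proof -
  let ?g = "\<lambda>t. cnj (\<phi> t) * u t"
  have g: "?g \<in> L2" using assms by (intro Linf_mult_L2 Linf_cnj H2_L2)
  have "l2_inner (toeplitz \<phi> f) u = l2_inner f (P_H2 ?g)" if "f \<in> H2" for f
  proof -
    have "l2_inner (toeplitz \<phi> f) u = l2_inner f ?g"
      using assms that by (simp add: l2_inner_toeplitz l2_inner_mult_left)
    also have "\<dots> = l2_inner f (P_H2 ?g)"
      using l2_inner_P_H2[OF g that] by (metis cnj_l2_inner)
    finally show ?thesis .
  qed
  with P_H2_in_H2[OF g]
  have "\<exists>h. h \<in> H2 \<and> (\<forall>f\<in>H2. l2_inner (toeplitz \<phi> f) u = l2_inner f h)" by blast
  then show ?thesis unfolding h2_adjoint_def by (rule someI_ex)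
qed

text \<open>The adjoint relation is tested on the monomial \<open>zpow k\<close>.\<close>

lemma fourier_coeff_h2_adjoint_toeplitz:
  assumes "\<phi> \<in> Linf" "u \<in> H2" "\<forall>j. 0 \<le> k $ j"
  shows "fourier_coeff (h2_adjoint (toeplitz \<phi>) u) k = cnj (l2_inner (\<lambda>t. \<phi> t * zpow k t) u)"
proof -
  have "fourier_coeff (h2_adjoint (toeplitz \<phi>) u) k = cnj (l2_inner (zpow k) (h2_adjoint (toeplitz \<phi>) u))"
    by (simp add: fourier_coeff_def cnj_l2_inner)
  also have "l2_inner (zpow k) (h2_adjoint (toeplitz \<phi>) u) = l2_inner (toeplitz \<phi> (zpow k)) u"
    using h2_adjoint_toeplitz_characterization[OF assms(1,2)] zpow_H2[OF assms(3)] by auto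
  also have "\<dots> = l2_inner (\<lambda>t. \<phi> t * zpow k t) u"
    using assms by (intro l2_inner_toeplitz zpow_H2)
  finally show ?thesis .
qed

lemma fourier_coeff_toeplitz:
  assumes "\<phi> \<in> Linf" "f \<in> H2" "\<forall>j. 0 \<le> k $ j"
  shows "fourier_coeff (toeplitz \<phi> f) k = l2_inner (\<lambda>t. \<phi> t * f t) (zpow k)"
  unfolding fourier_coeff_def using assms by (intro l2_inner_toeplitz zpow_H2)

text \<open>The prescribed coefficients differ from the conjugates of those of \<open>f\<close> by
  unimodular factors, so a function with them exists. The \<theta>-phase is written as the conjugate
  of \<open>zpow k\<close> at the angle vector \<theta>, which makes the rules for
  \<open>zpow\<close> available.\<close>

lemma conjC_characterization:
  assumes "f \<in> L2"
  shows "conjC \<theta> \<xi> f \<in> H2 \<and> (\<forall>k. (\<forall>j. 0 \<le> k $ j) \<longrightarrow>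
    fourier_coeff (conjC \<theta> \<xi> f) k =
      exp (\<i> * complex_of_real (\<Sum>j\<in>UNIV. \<xi> $ j)) * cnj (fourier_coeff f k) * cnj (zpow k \<theta>))"
proof -
  let ?a = "\<lambda>k. exp (\<i> * complex_of_real (\<Sum>j\<in>UNIV. \<xi> $ j)) * cnj (fourier_coeff f k) * cnj (zpow k \<theta>)"
  have "cmod (?a k) \<le> cmod (fourier_coeff f k)" for k
    by (simp add: norm_mult)
  then have ex: "\<exists>h. h \<in> H2 \<and> (\<forall>k. (\<forall>j. 0 \<le> k $ j) \<longrightarrow> fourier_coeff h k = ?a k)"
    using H2_ex_fourier_coeff[OF assms, of ?a] by (simp only: Bex_def)
  have phase: "exp (- \<i> * complex_of_real (\<Sum>j\<in>UNIV. real_of_int (k $ j) * \<theta> $ j)) = cnj (zpow k \<theta>)" for k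
    by (simp add: zpow_def exp_cnj)
  show ?thesis unfolding conjC_def phase by (rule someI_ex[OF ex])
qed

lemma conjC_in_H2: "f \<in> H2 \<Longrightarrow> conjC \<theta> \<xi> f \<in> H2"
  using conjC_characterization H2_L2 by blast

lemma fourier_coeff_conjC:
  "f \<in> H2 \<Longrightarrow> \<forall>j. 0 \<le> k $ j \<Longrightarrow> fourier_coeff (conjC \<theta> \<xi> f) k =
      exp (\<i> * complex_of_real (\<Sum>j\<in>UNIV. \<xi> $ j)) * cnj (fourier_coeff f k) * cnj (zpow k \<theta>)"
  using conjC_characterization[OF H2_L2] by blast

lemma fourier_coeff_mult_zpow: "fourier_coeff (\<lambda>t. \<phi> t * zpow k t) m = fourier_coeff \<phi> (m - k)"
  by (simp add: fourier_coeff_def l2_inner_def zpow_diff mult_ac)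

text \<open>Both sides of the symmetry equation lie in \<open>H2\<close>, so their coefficients are
  compared. The conjugate in the coefficient of the adjoint is undone by the one in the outer
  conjugation.\<close>

lemma C_symmetric_toeplitz_iff:
  assumes "\<phi> \<in> Linf"
  shows "C_symmetric (conjC \<theta> \<xi>) (toeplitz \<phi>) \<longleftrightarrow>
    (\<forall>f\<in>H2. \<forall>k. (\<forall>j. 0 \<le> k $ j) \<longrightarrow>
      exp (\<i> * complex_of_real (\<Sum>j\<in>UNIV. \<xi> $ j)) * cnj (zpow k \<theta>)
        * l2_inner (\<lambda>t. \<phi> t * zpow k t) (conjC \<theta> \<xi> f) = l2_inner (\<lambda>t. \<phi> t * f t) (zpow k))"
proof -
  have "(AE t in TM. conjC \<theta> \<xi> (h2_adjoint (toeplitz \<phi>) (conjC \<theta> \<xi> f)) t = toeplitz \<phi> f t) \<longleftrightarrow>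
    (\<forall>k. (\<forall>j. 0 \<le> k $ j) \<longrightarrow>
      exp (\<i> * complex_of_real (\<Sum>j\<in>UNIV. \<xi> $ j)) * cnj (zpow k \<theta>)
        * l2_inner (\<lambda>t. \<phi> t * zpow k t) (conjC \<theta> \<xi> f) = l2_inner (\<lambda>t. \<phi> t * f t) (zpow k))"
    if f: "f \<in> H2" for f
  proof -
    have C: "conjC \<theta> \<xi> f \<in> H2" by (rule conjC_in_H2[OF f])
    have ad: "h2_adjoint (toeplitz \<phi>) (conjC \<theta> \<xi> f) \<in> H2"
      using h2_adjoint_toeplitz_characterization[OF assms C] by blast
    have "fourier_coeff (conjC \<theta> \<xi> (h2_adjoint (toeplitz \<phi>) (conjC \<theta> \<xi> f))) k =
      exp (\<i> * complex_of_real (\<Sum>j\<in>UNIV. \<xi> $ j)) * cnj (zpow k \<theta>)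
        * l2_inner (\<lambda>t. \<phi> t * zpow k t) (conjC \<theta> \<xi> f)" if "\<forall>j. 0 \<le> k $ j" for k
      by (simp add: fourier_coeff_conjC[OF ad that] fourier_coeff_h2_adjoint_toeplitz[OF assms C that])
    then show ?thesis
      using fourier_coeff_toeplitz[OF assms f]
      by (simp add: H2_AE_eq_iff[OF conjC_in_H2[OF ad] toeplitz_in_H2[OF assms f]])
  qed
  then show ?thesis by (simp add: C_symmetric_def)
qed

theorem theorem9p6:
  fixes \<theta> \<xi> :: "real^'d::finite" and \<phi> :: "real^'d \<Rightarrow> complex"
  assumes "CARD('d) \<ge> 2" and "\<phi> \<in> Linf"
  shows "C_symmetric (conjC \<theta> \<xi>) (toeplitz \<phi>) \<longleftrightarrow>
    (\<forall>k::int^'d. exp (\<i> * complex_of_real (\<Sum>j\<in>UNIV. real_of_int (k$j) * \<theta>$j)) * fourier_coeff \<phi> k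
        = fourier_coeff \<phi> (- k))"
proof -
  define e where "e = exp (\<i> * complex_of_real (\<Sum>j\<in>UNIV. \<xi> $ j))"
  \<comment> \<open>The \<xi>-phase enters once through the outer conjugation and once, conjugated,
    through the inner one; this identity removes it.\<close>
  have e: "e * cnj e = 1" by (simp add: e_def exp_cnj flip: exp_add)
  note \<phi> = assms(2)
  have \<phi>z: "(\<lambda>t. \<phi> t * zpow k t) \<in> L2" for k
    by (intro Linf_mult_L2 \<phi> zpow_L2)
  note sym = C_symmetric_toeplitz_iff[OF \<phi>, of \<theta> \<xi>, folded e_def]
  note C_coeff = fourier_coeff_conjC[of _ _ \<theta> \<xi>, folded e_def]
  show ?thesis unfolding zpow_def[symmetric]
  proof
    assume "C_symmetric (conjC \<theta> \<xi>) (toeplitz \<phi>)"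
    then have S: "e * cnj (zpow k \<theta>) * l2_inner (\<lambda>t. \<phi> t * zpow k t) (conjC \<theta> \<xi> f)
        = l2_inner (\<lambda>t. \<phi> t * f t) (zpow k)" if "f \<in> H2" "\<forall>j. 0 \<le> k $ j" for f k
      using sym that by blast
    show "\<forall>k. zpow k \<theta> * fourier_coeff \<phi> k = fourier_coeff \<phi> (- k)"
    proof
      fix n :: "int^'d"
      \<comment> \<open>Positive and negative parts of \<open>n\<close>: both lie in the cone, and
        their difference is \<open>n\<close>.\<close>
      define m where "m = (\<chi> j. max 0 (n $ j))"
      define k where "k = (\<chi> j. max 0 (- n $ j))"
      have m: "\<forall>j. 0 \<le> m $ j" and k: "\<forall>j. 0 \<le> k $ j" and n: "n = m - k"
        by (auto simp: m_def k_def vec_eq_iff)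
      let ?c = "e * cnj (zpow m \<theta>)"
      have zm: "zpow m \<in> H2" by (rule zpow_H2[OF m])
      have cz: "(\<lambda>t. ?c * zpow m t) \<in> H2" by (rule cmult_zpow_H2[OF m])
      \<comment> \<open>The conjugation maps a monomial to a multiple of itself, but only almost
        everywhere, because its values are chosen representatives.\<close>
      have "AE t in TM. conjC \<theta> \<xi> (zpow m) t = ?c * zpow m t"
        unfolding H2_AE_eq_iff[OF conjC_in_H2[OF zm] cz]
        using fourier_coeff_cmult_zpow[of 1 m]
        by (simp add: C_coeff zm fourier_coeff_cmult_zpow)
      then have "l2_inner (conjC \<theta> \<xi> (zpow m)) (\<lambda>t. \<phi> t * zpow k t)
          = ?c * l2_inner (zpow m) (\<lambda>t. \<phi> t * zpow k t)"
        unfolding l2_inner_cmult_left[symmetric]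
        by (intro l2_inner_AE_cong_left H2_L2 conjC_in_H2 zm cz \<phi>z)
      \<comment> \<open>Congruence and scalar multiples were available in the left argument of the
        inner product; conjugating moves the result to the right argument, where \<open>S\<close>
        has it.\<close>
      then have "cnj (l2_inner (conjC \<theta> \<xi> (zpow m)) (\<lambda>t. \<phi> t * zpow k t))
          = cnj ?c * cnj (l2_inner (zpow m) (\<lambda>t. \<phi> t * zpow k t))" by simp
      then have C: "l2_inner (\<lambda>t. \<phi> t * zpow k t) (conjC \<theta> \<xi> (zpow m)) = cnj ?c * fourier_coeff \<phi> (m - k)"
        using fourier_coeff_mult_zpow[of \<phi> k m] by (simp only: cnj_l2_inner fourier_coeff_def)
      have "fourier_coeff \<phi> (k - m) = l2_inner (\<lambda>t. \<phi> t * zpow m t) (zpow k)"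
        using fourier_coeff_mult_zpow[of \<phi> m k] by (simp only: fourier_coeff_def)
      also have "\<dots> = e * cnj (zpow k \<theta>) * (cnj ?c * fourier_coeff \<phi> (m - k))"
        using S[OF zm k] by (simp only: C)
      also have "\<dots> = (e * cnj e) * (zpow m \<theta> * cnj (zpow k \<theta>)) * fourier_coeff \<phi> (m - k)"
        by (simp add: mult_ac)
      finally have "fourier_coeff \<phi> (k - m) = zpow (m - k) \<theta> * fourier_coeff \<phi> (m - k)"
        by (simp add: e zpow_diff)
      then show "zpow n \<theta> * fourier_coeff \<phi> n = fourier_coeff \<phi> (- n)"
        by (simp add: n)
    qed
  next
    assume R: "\<forall>k. zpow k \<theta> * fourier_coeff \<phi> k = fourier_coeff \<phi> (- k)"
    show "C_symmetric (conjC \<theta> \<xi>) (toeplitz \<phi>)"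
      unfolding sym
    proof (intro ballI allI impI)
      fix f :: "real^'d \<Rightarrow> complex" and k :: "int^'d"
      assume f: "f \<in> H2" and k: "\<forall>j. 0 \<le> k $ j"
      note C = conjC_in_H2[OF f, of \<theta> \<xi>]
      let ?F = "\<lambda>m. fourier_coeff \<phi> (m - k) * cnj (fourier_coeff (conjC \<theta> \<xi> f) m)"
      let ?G = "\<lambda>m. fourier_coeff f m * fourier_coeff \<phi> (k - m)"
      \<comment> \<open>Termwise form of the identity to be proved: on the cone it is the relation
        \<open>R\<close> at \<open>m - k\<close>, off the cone both sides are zero.\<close>
      have FG: "e * cnj (zpow k \<theta>) * ?F m = ?G m" for m
      proof (cases "\<forall>j. 0 \<le> m $ j")
        case True
        have "e * cnj (zpow k \<theta>) * ?F m = (e * cnj e) * fourier_coeff f m * (zpow (m - k) \<theta> * fourier_coeff \<phi> (m - k))"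
          by (simp add: C_coeff[OF f True] zpow_diff mult_ac)
        also have "\<dots> = ?G m"
          using R by (simp add: e)
        finally show ?thesis .
      next
        case False
        then show ?thesis using H2_fourier_coeff[OF f] H2_fourier_coeff[OF C] by simp
      qed
      have "(\<lambda>n. \<Sum>m\<in>initial_segment n. ?F m) \<longlonglongrightarrow> l2_inner (\<lambda>t. \<phi> t * zpow k t) (conjC \<theta> \<xi> f)"
        using Parseval[OF \<phi>z H2_L2[OF C], of k] by (simp add: fourier_coeff_mult_zpow)
      from tendsto_mult_left[OF this, of "e * cnj (zpow k \<theta>)"]
      have "(\<lambda>n. \<Sum>m\<in>initial_segment n. ?G m)
        \<longlonglongrightarrow> e * cnj (zpow k \<theta>) * l2_inner (\<lambda>t. \<phi> t * zpow k t) (conjC \<theta> \<xi> f)"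
        unfolding sum_distrib_left FG .
      moreover have "(\<lambda>n. \<Sum>m\<in>initial_segment n. ?G m) \<longlonglongrightarrow> l2_inner (\<lambda>t. \<phi> t * f t) (zpow k)"
      proof -
        \<comment> \<open>The symbol is moved to the right-hand argument, so that Parseval expands
          in the coefficients of \<open>f\<close> itself and produces exactly the terms
          \<open>?G m\<close>.\<close>
        have g: "(\<lambda>t. cnj (\<phi> t) * zpow k t) \<in> L2" by (intro Linf_mult_L2 Linf_cnj \<phi> zpow_L2)
        have "cnj (fourier_coeff (\<lambda>t. cnj (\<phi> t) * zpow k t) m) = fourier_coeff \<phi> (k - m)" for m
          unfolding cnj_fourier_coeff l2_inner_mult_left[symmetric] fourier_coeff_mult_zpow[symmetric]
          by (simp add: fourier_coeff_def)
        then show ?thesis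
          using Parseval[OF H2_L2[OF f] g] by (simp add: l2_inner_mult_left)
      qed
      ultimately show "e * cnj (zpow k \<theta>) * l2_inner (\<lambda>t. \<phi> t * zpow k t) (conjC \<theta> \<xi> f)
        = l2_inner (\<lambda>t. \<phi> t * f t) (zpow k)"
        by (rule LIMSEQ_unique)
    qed
  qed
qed

end
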